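(* For any $m\in\mathbb{Z}_{>0}$, $$\Gamma(m)=\left\{\mu\in\Lambda(m):\ \text{for all } j\in J_\mu,\ \binom{m}{j}\equiv 0\pmod p\right\},$$ where $J_\mu=\{j\in\mathbb{Z}_{\ge0}: m-\mu_2<j<\mu_1\}$.
   Context: Let $p$ be a prime, $\mathbb{F}=\mathbb{F}_p$, $S=\mathbb{F}[x,y]$, $\mathrm{Der}_S=S\partial_x\oplus S\partial_y$. Let $\mathcal{A}=\{H_1,H_2,H_3\}$ with $H_1=\ker x$, $H_2=\ker y$, $H_3=\ker(x+y)$, $\alpha_1=x,\alpha_2=y,\alpha_3=x+y$. For $\mu=(\mu_1,\mu_2,\mu_3)\in\mathbb{Z}_{\ge0}^3$, $D(\mathcal{A},\mu)=\{\theta\in\mathrm{Der}_S:\theta(\alpha_i)\in\alpha_i^{\mu_i}S,\ i=1,2,3\}$. Let $\Lambda(m)=\{\mu\in\mathbb{Z}_{\ge0}^3:\mu_3=m\}$. For $\mu\in\Lambda(m)$ let $\psi_\mu=\sum_{j=\mu_1}^{m}\binom{m}{j}x^jy^{m-j}\partial_x+\sum_{j=0}^{\mu_1-1}\binom{m}{j}x^jy^{m-j}\partial_y$ (binomial coefficients read in $\mathbb{F}_p$; empty sums are zero) and $\psi'_\mu=x^{\mu_1}y^{\mu_2}(\partial_y-\partial_x)$, and let $\Gamma(m)=\{\mu\in\Lambda(m):\{\psi_\mu,\psi'_\mu\}\text{ is a basis for }D(\mathcal{A},\mu)\}$. *)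

theory Defs
  imports
    "Berlekamp_Zassenhaus.Finite_Field"
    "HOL-Computational_Algebra.Polynomial"
    "HOL-Number_Theory.Cong"
    "HOL-Library.Function_Algebras"
begin

text \<open>
  The field with \<open>p\<close> elements is \<^typ>\<open>'p mod_ring\<close>, where \<open>'p\<close> is of class
  \<^class>\<open>prime_card\<close> and \<open>p = CARD('p)\<close>.  The ring \<open>S\<close> of polynomials in \<open>x\<close> and \<open>y\<close>
  is rendered as (polynomials in \<open>x\<close>) in \<open>y\<close>: \<open>y\<close> is the outer and \<open>x\<close> the inner variable.
\<close>

type_synonym 'p S = "'p mod_ring poly poly"

definition X :: "'p::prime_card S" where
  "X = [:[:0, 1:]:]"

definition Y :: "'p::prime_card S" where
  "Y = [:0, 1:]"

text \<open>
  A derivation is a map from \<open>S\<close> to \<open>S\<close>; sums and differences of derivations are the pointwise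
  ones.
\<close>

type_synonym 'p der = "'p S \<Rightarrow> 'p S"

definition dx :: "'p::prime_card der" where
  "dx f = map_poly pderiv f"

definition dy :: "'p::prime_card der" where
  "dy f = pderiv f"

definition smul :: "'p::prime_card S \<Rightarrow> 'p der \<Rightarrow> 'p der" where
  "smul s \<theta> = (\<lambda>f. s * \<theta> f)"

interpretation der: Modules.module "smul :: 'p::prime_card S \<Rightarrow> 'p der \<Rightarrow> 'p der"
  by unfold_locales (auto simp: smul_def plus_fun_def algebra_simps)

lemma dx_X [simp]: "dx X = 1"
  by (simp add: dx_def X_def map_poly_pCons pderiv_pCons one_pCons)

lemma dx_Y [simp]: "dx Y = 0"
  by (simp add: dx_def Y_def map_poly_pCons pderiv_pCons)

lemma dy_X [simp]: "dy X = 0"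
  by (simp add: dy_def X_def pderiv_pCons)

lemma dy_Y [simp]: "dy Y = 1"
  by (simp add: dy_def Y_def pderiv_pCons one_pCons)

definition Der :: "'p::prime_card der set" where
  "Der = {smul f dx + smul g dy | f g. True}"

text \<open>
  The arrangement consists of the kernels of \<open>x\<close>, \<open>y\<close> and \<open>x + y\<close>; it enters only through
  these defining forms.  Membership in the ideal \<open>\<alpha>\<^sub>i ^ \<mu>\<^sub>i S\<close> is divisibility.
\<close>

fun D :: "nat \<times> nat \<times> nat \<Rightarrow> 'p::prime_card der set" where
  "D (\<mu>1, \<mu>2, \<mu>3) =
     {\<theta> \<in> Der. X ^ \<mu>1 dvd \<theta> X \<and> Y ^ \<mu>2 dvd \<theta> Y \<and> (X + Y) ^ \<mu>3 dvd \<theta> (X + Y)}"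

definition is_basis :: "'p::prime_card der set \<Rightarrow> 'p der set \<Rightarrow> bool" where
  "is_basis B M \<longleftrightarrow> der.independent B \<and> der.span B = M"

definition \<Lambda> :: "nat \<Rightarrow> (nat \<times> nat \<times> nat) set" where
  "\<Lambda> m = {(\<mu>1, \<mu>2, \<mu>3). \<mu>3 = m}"

text \<open>
  In the second sum \<open>j\<close> may exceed \<open>m\<close>, so that \<open>m - j\<close> is truncated; the binomial
  coefficient then vanishes.
\<close>

fun \<psi> :: "nat \<times> nat \<times> nat \<Rightarrow> 'p::prime_card der" where
  "\<psi> (\<mu>1, \<mu>2, m) =
     smul (\<Sum>j = \<mu>1..m. of_nat (m choose j) * X ^ j * Y ^ (m - j)) dx +
     smul (\<Sum>j<\<mu>1. of_nat (m choose j) * X ^ j * Y ^ (m - j)) dy"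

fun \<psi>' :: "nat \<times> nat \<times> nat \<Rightarrow> 'p::prime_card der" where
  "\<psi>' (\<mu>1, \<mu>2, m) = smul (X ^ \<mu>1 * Y ^ \<mu>2) (dy - dx)"

definition \<Gamma> :: "'p::prime_card itself \<Rightarrow> nat \<Rightarrow> (nat \<times> nat \<times> nat) set" where
  "\<Gamma> _ m = {\<mu> \<in> \<Lambda> m. is_basis {\<psi> \<mu>, \<psi>' \<mu>} (D \<mu> :: 'p der set)}"

text \<open>The lower bound \<open>m - \<mu>\<^sub>2\<close> may be negative.\<close>

fun J :: "nat \<times> nat \<times> nat \<Rightarrow> nat set" where
  "J (\<mu>1, \<mu>2, m) = {j. int m - int \<mu>2 < int j \<and> j < \<mu>1}"

end

theory Submission
  imports Defs
begin

text \<open>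
  On \<open>x + y\<close> the derivations \<open>\<psi>\<close> and \<open>\<psi>'\<close> take the values \<open>(x + y)\<^sup>m\<close> and \<open>0\<close>. Hence
  subtracting from \<open>\<theta>\<close> in \<open>D(\<A>, \<mu>)\<close> the multiple of \<open>\<psi>\<close> with the same value on \<open>x + y\<close>
  leaves \<open>h (\<partial>\<^sub>y - \<partial>\<^sub>x)\<close> with \<open>h\<close> divisible by \<open>x\<^bsup>\<mu>1\<^esup>\<close> and \<open>y\<^bsup>\<mu>2\<^esup>\<close>, provided \<open>\<psi>\<close> itself lies in
  the module. So the pair is a basis as soon as \<open>\<psi>\<close> is in the module, and the only condition
  for this that can fail is \<open>y\<^bsup>\<mu>2\<^esup> dvd \<psi> y\<close>, which is the vanishing of the binomial
  coefficients.
\<close>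

section \<open>Coefficients and monomials in \<open>S\<close>\<close>

lemma of_nat_mod_ring_eq_0_iff:
  "(of_nat n :: 'p::prime_card mod_ring) = 0 \<longleftrightarrow> [n = 0] (mod CARD('p))"
proof -
  have "(of_nat n :: 'p mod_ring) = 0" if "CARD('p) dvd n"
    using that by (auto elim!: dvdE)
  then show ?thesis
    using of_nat_0_mod_ring_dvd[where 'a = 'p] by (auto simp: cong_0_iff)
qed

lemma X_power: "X ^ j = ([:monom 1 j:] :: 'p::prime_card S)"
  by (simp add: X_def poly_const_pow flip: monom_altdef) (simp add: monom_altdef)

lemma Y_power: "Y ^ j = (monom 1 j :: 'p::prime_card S)"
  by (simp add: Y_def monom_altdef)

lemma X_plus_Y_nonzero: "X + Y \<noteq> (0 :: 'p::prime_card S)"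
  by (simp add: X_def Y_def)

text \<open>Division by a power of \<open>Y\<close> merely shifts the coefficients with respect to
  the outer variable, and divisibility by \<open>X ^ a\<close> is tested on each of these
  coefficients. So it passes from \<open>h\<close> to its quotient by \<open>Y ^ b\<close>.\<close>

lemma XY_power_dvd:
  fixes h :: "'p::prime_card S"
  assumes "X ^ a dvd h" "Y ^ b dvd h"
  shows "X ^ a * Y ^ b dvd h"
proof -
  obtain q where q: "h = Y ^ b * q"
    using assms(2) by blast
  have "monom 1 a dvd coeff q n" for n
  proof -
    have "monom 1 a dvd coeff h (n + b)"
      using assms(1) by (simp only: X_power const_poly_dvd_iff)
    then show ?thesis
      by (simp add: q Y_power coeff_monom_mult)
  qed
  then have "X ^ a dvd q"
    by (simp add: X_power const_poly_dvd_iff)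
  then show ?thesis
    by (simp add: q mult.commute mult_dvd_mono)
qed

lemma binomial_summand_eq_monom:
  "of_nat c * X ^ j * Y ^ k = (monom (monom (of_nat c) j) k :: 'p::prime_card S)"
  by (simp add: X_power Y_power of_nat_poly smult_monom)

section \<open>Derivations and their values on \<open>X\<close> and \<open>Y\<close>\<close>

lemma Der_apply:
  assumes "\<theta> \<in> Der"
  shows "\<theta> f = \<theta> X * dx f + \<theta> Y * dy f"
  using assms by (auto simp: Der_def smul_def)

lemma Der_apply_add:
  assumes "\<theta> \<in> Der"
  shows "\<theta> (f + g) = \<theta> f + \<theta> g"
proof -
  have "dx (f + g) = dx f + dx g"
    by (simp add: dx_def poly_eq_iff coeff_map_poly pderiv_add)
  then show ?thesis
    by (simp add: Der_apply[OF assms, of "f + g"] Der_apply[OF assms, of f]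
        Der_apply[OF assms, of g] dy_def pderiv_add algebra_simps)
qed

lemma smul_dx_plus_smul_dy_in_Der: "smul f dx + smul g dy \<in> Der"
  by (auto simp: Der_def)

lemma subspace_Der: "der.subspace Der"
proof (rule der.subspaceI)
  show "0 \<in> Der"
    using smul_dx_plus_smul_dy_in_Der[of 0 0] by (simp only: der.scale_zero_left add_0)
next
  fix \<theta> \<eta> :: "'a der"
  assume "\<theta> \<in> Der" "\<eta> \<in> Der"
  then obtain f g f' g' where "\<theta> = smul f dx + smul g dy" "\<eta> = smul f' dx + smul g' dy"
    by (auto simp: Der_def)
  then have "\<theta> + \<eta> = smul (f + f') dx + smul (g + g') dy"
    by (simp only: der.scale_left_distrib ac_simps)
  then show "\<theta> + \<eta> \<in> Der"
    by (simp only: smul_dx_plus_smul_dy_in_Der)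
next
  fix c and \<theta> :: "'a der"
  assume "\<theta> \<in> Der"
  then obtain f g where "\<theta> = smul f dx + smul g dy"
    by (auto simp: Der_def)
  then have "smul c \<theta> = smul (c * f) dx + smul (c * g) dy"
    by (simp only: der.scale_right_distrib der.scale_scale)
  then show "smul c \<theta> \<in> Der"
    by (simp only: smul_dx_plus_smul_dy_in_Der)
qed

lemma subspace_D: "der.subspace (D \<mu>)"
proof (cases \<mu>)
  case (fields a b m)
  show ?thesis
    unfolding fields using subspace_Der
    by (auto simp: der.subspace_def smul_def)
qed

lemma \<psi>_in_Der: "\<psi> \<mu> \<in> Der"
  by (cases \<mu>) (simp add: smul_dx_plus_smul_dy_in_Der)

lemma \<psi>'_in_Der: "(\<psi>' \<mu> :: 'p::prime_card der) \<in> Der"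
proof (cases \<mu>)
  case (fields a b m)
  have "(\<psi>' \<mu> :: 'p der) = smul (- (X ^ a * Y ^ b)) dx + smul (X ^ a * Y ^ b) dy"
    by (simp add: fields der.scale_right_diff_distrib)
  then show ?thesis
    by (simp only: smul_dx_plus_smul_dy_in_Der)
qed

lemma \<psi>_X:
  "\<psi> (a, b, m) X = (\<Sum>j = a..m. of_nat (m choose j) * X ^ j * Y ^ (m - j))"
  by (simp add: smul_def)

lemma \<psi>_Y:
  "\<psi> (a, b, m) Y = (\<Sum>j<a. of_nat (m choose j) * X ^ j * Y ^ (m - j))"
  by (simp add: smul_def)

text \<open>The two coefficient sums are the binomial expansion of \<open>(X + Y) ^ m\<close>, cut
  at the index \<open>a\<close>.\<close>

lemma \<psi>_X_plus_Y: "\<psi> (a, b, m) (X + Y) = (X + Y) ^ m"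
proof -
  let ?t = "\<lambda>j. of_nat (m choose j) * X ^ j * Y ^ (m - j) :: 'a S"
  have "\<psi> (a, b, m) (X + Y) = (\<Sum>j = a..m. ?t j) + (\<Sum>j<a. ?t j)"
    by (simp only: Der_apply_add[OF \<psi>_in_Der] \<psi>_X \<psi>_Y)
  also have "\<dots> = sum ?t ({a..m} \<union> {..<a})"
    by (rule sum.union_disjoint[symmetric]) auto
  also have "\<dots> = sum ?t {..m}"
  \<comment> \<open>For \<open>a > m + 1\<close> the union runs past \<open>m\<close>; the extra
    binomial coefficients vanish.\<close>
  proof (rule sum.mono_neutral_right)
    have "?t j = 0" if "j \<notin> {..m}" for j
      using that by (simp add: binomial_eq_0)
    then show "\<forall>j \<in> {a..m} \<union> {..<a} - {..m}. ?t j = 0"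
      by blast
  qed auto
  finally show ?thesis
    by (simp only: binomial_ring)
qed

lemma \<psi>'_X: "\<psi>' (a, b, m) X = - (X ^ a * Y ^ b)"
  and \<psi>'_Y: "\<psi>' (a, b, m) Y = X ^ a * Y ^ b"
  by (simp_all add: smul_def)

lemma \<psi>'_X_plus_Y: "\<psi>' (a, b, m) (X + Y) = 0"
  by (simp only: Der_apply_add[OF \<psi>'_in_Der] \<psi>'_X \<psi>'_Y) simp

section \<open>Membership in the module of the arrangement\<close>

lemma \<psi>'_in_D: "\<psi>' \<mu> \<in> D \<mu>"
  by (cases \<mu>) (simp only: D.simps mem_Collect_eq \<psi>'_in_Der \<psi>'_X \<psi>'_Y \<psi>'_X_plus_Y, simp)

lemma X_power_dvd_\<psi>_X: "X ^ a dvd \<psi> (a, b, m) X"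
  unfolding \<psi>_X by (intro dvd_sum dvd_mult2 dvd_mult le_imp_power_dvd) simp

text \<open>The nonzero summands are multiples of distinct monomials, so no cancellation can help:
  \<open>Y ^ b\<close> must divide each of them. Among the indices \<open>j < a\<close> with
  \<open>j \<le> m\<close>, those in \<open>J\<close> are the ones whose \<open>Y\<close>-exponent
  \<open>m - j\<close> is too small.\<close>

lemma Y_power_dvd_\<psi>_Y_iff:
  "Y ^ b dvd (\<psi> (a, b, m) Y :: 'p::prime_card S) \<longleftrightarrow>
    (\<forall>j \<in> J (a, b, m). [m choose j = 0] (mod CARD('p)))"
proof
  assume dvd: "Y ^ b dvd (\<psi> (a, b, m) Y :: 'p S)"
  show "\<forall>j \<in> J (a, b, m). [m choose j = 0] (mod CARD('p))"
  proof
    fix j assume j: "j \<in> J (a, b, m)"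
    show "[m choose j = 0] (mod CARD('p))"
    \<comment> \<open>If \<open>a > m + 1\<close>, then \<open>J\<close> also contains indices
      beyond \<open>m\<close>, where the binomial coefficient is zero as a natural number.\<close>
    proof (cases "j \<le> m")
      case True
      \<comment> \<open>The exponent of \<open>X\<close> alone identifies the summand, so truncation
        of \<open>m - i\<close> for \<open>i > m\<close> does no harm.\<close>
      have "coeff (coeff (\<psi> (a, b, m) Y :: 'p S) (m - j)) j =
          (\<Sum>i<a. if i = j then of_nat (m choose j) else 0)"
        unfolding \<psi>_Y binomial_summand_eq_monom coeff_sum
        using True by (intro sum.cong) (auto simp: if_distrib)
      also have "\<dots> = of_nat (m choose j)"
        using j by simp
      finally have "of_nat (m choose j) = coeff (coeff (\<psi> (a, b, m) Y :: 'p S) (m - j)) j"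
        by (rule sym)
      also have "m - j < b"
        using j True by auto
      then have "coeff (\<psi> (a, b, m) Y :: 'p S) (m - j) = 0"
        using dvd by (simp only: Y_power monom_1_dvd_iff')
      finally show ?thesis
        by (simp add: of_nat_mod_ring_eq_0_iff)
    qed (simp add: not_le binomial_eq_0)
  qed
next
  assume vanish: "\<forall>j \<in> J (a, b, m). [m choose j = 0] (mod CARD('p))"
  show "Y ^ b dvd (\<psi> (a, b, m) Y :: 'p S)"
    unfolding \<psi>_Y
  proof (rule dvd_sum)
    fix j assume "j \<in> {..<a}"
    show "Y ^ b dvd (of_nat (m choose j) * X ^ j * Y ^ (m - j) :: 'p S)"
    proof (cases "j \<in> J (a, b, m)")
      case True
      then have "of_nat (m choose j) = (0 :: 'p mod_ring)"
        using vanish by (simp only: of_nat_mod_ring_eq_0_iff)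
      then show ?thesis
        by (simp add: binomial_summand_eq_monom)
    next
      case False
      \<comment> \<open>Outside \<open>J\<close>, an index \<open>j < a\<close> satisfies
        \<open>j + b \<le> m\<close>, so the subtraction is not truncated.\<close>
      then have "b \<le> m - j"
        using \<open>j \<in> {..<a}\<close> by auto
      then show ?thesis
        by (intro dvd_mult le_imp_power_dvd)
    qed
  qed
qed

lemma \<psi>_in_D_iff:
  "(\<psi> \<mu> :: 'p::prime_card der) \<in> D \<mu> \<longleftrightarrow>
    (\<forall>j \<in> J \<mu>. [snd (snd \<mu>) choose j = 0] (mod CARD('p)))"
  by (cases \<mu>)
    (simp only: D.simps mem_Collect_eq \<psi>_in_Der \<psi>_X_plus_Y X_power_dvd_\<psi>_X
      Y_power_dvd_\<psi>_Y_iff snd_conv simp_thms dvd_refl)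

section \<open>Independence and spanning\<close>

lemma \<psi>_neq_\<psi>': "\<psi> (a, b, m) \<noteq> (\<psi>' (a, b, m) :: 'p::prime_card der)"
proof
  assume "\<psi> (a, b, m) = (\<psi>' (a, b, m) :: 'p der)"
  then have "(X + Y :: 'p S) ^ m = 0"
    by (metis \<psi>_X_plus_Y \<psi>'_X_plus_Y)
  then show False
    by (simp add: X_plus_Y_nonzero)
qed

text \<open>Evaluating a linear relation at \<open>X + Y\<close> removes \<open>\<psi>'\<close> and
  leaves a multiple of the nonzero \<open>(X + Y) ^ m\<close> in a domain. Evaluation at
  \<open>Y\<close> then isolates \<open>\<psi>'\<close>.\<close>

lemma independent_\<psi>_\<psi>': "der.independent {\<psi> (a, b, m), \<psi>' (a, b, m) :: 'p::prime_card der}"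
proof
  assume "der.dependent {\<psi> (a, b, m), \<psi>' (a, b, m) :: 'p der}"
  then obtain u :: "'p der \<Rightarrow> 'p S" where
    nz: "u (\<psi> (a, b, m)) \<noteq> 0 \<or> u (\<psi>' (a, b, m) :: 'p der) \<noteq> 0" and
    "smul (u (\<psi> (a, b, m))) (\<psi> (a, b, m)) + smul (u (\<psi>' (a, b, m))) (\<psi>' (a, b, m)) = 0"
    \<comment> \<open>Distinctness makes the sum over the set split into two terms.\<close>
    using \<psi>_neq_\<psi>'[of a b m, where 'p = 'p]
    by (auto simp: der.dependent_finite simp del: \<psi>.simps \<psi>'.simps)
  then have rel: "u (\<psi> (a, b, m)) * \<psi> (a, b, m) f + u (\<psi>' (a, b, m)) * \<psi>' (a, b, m) f = 0" for f
    by (simp add: smul_def fun_eq_iff del: \<psi>.simps \<psi>'.simps)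
  have u: "u (\<psi> (a, b, m)) = 0"
    using rel[of "X + Y"] X_plus_Y_nonzero[where 'p = 'p]
    by (simp add: \<psi>_X_plus_Y \<psi>'_X_plus_Y del: \<psi>.simps \<psi>'.simps)
  moreover have "u (\<psi>' (a, b, m)) = 0"
    using rel[of Y]
    by (simp add: u \<psi>'_Y X_power Y_power del: \<psi>.simps \<psi>'.simps)
  ultimately show False
    using nz by simp
qed

lemma D_subset_span:
  assumes "(\<psi> (a, b, m) :: 'p::prime_card der) \<in> D (a, b, m)"
  shows "D (a, b, m) \<subseteq> der.span {\<psi> (a, b, m), \<psi>' (a, b, m) :: 'p der}"
proof
  fix \<theta> :: "'p der" assume \<theta>: "\<theta> \<in> D (a, b, m)"
  then have "(X + Y) ^ m dvd \<theta> (X + Y)"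
    by simp
  then obtain c where c: "\<theta> (X + Y) = (X + Y) ^ m * c"
    by (rule dvdE)
  define \<eta> where "\<eta> = \<theta> - smul c (\<psi> (a, b, m))"
  have \<eta>: "\<eta> \<in> D (a, b, m)"
    unfolding \<eta>_def using \<theta> assms
    by (intro der.subspace_diff der.subspace_scale subspace_D)
  then have \<eta>_Der: "\<eta> \<in> Der" and dvd: "X ^ a dvd \<eta> X" "Y ^ b dvd \<eta> Y"
    by auto
  have "\<eta> (X + Y) = 0"
    by (simp add: \<eta>_def c smul_def \<psi>_X_plus_Y del: \<psi>.simps)
  \<comment> \<open>Up to sign the two values now agree, so both divisibility conditions fall on the
    single polynomial \<open>\<eta> Y\<close>.\<close>
  then have \<eta>_X: "\<eta> X = - \<eta> Y"
    by (simp add: Der_apply_add[OF \<eta>_Der] eq_neg_iff_add_eq_0)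
  then have "X ^ a * Y ^ b dvd \<eta> Y"
    using dvd by (simp add: XY_power_dvd)
  then obtain d where d: "\<eta> Y = X ^ a * Y ^ b * d"
    by (rule dvdE)
  have "\<eta> = smul d (\<psi>' (a, b, m))"
  proof
    show "\<eta> f = smul d (\<psi>' (a, b, m)) f" for f
      by (subst Der_apply[OF \<eta>_Der]) (simp add: \<eta>_X d smul_def algebra_simps)
  qed
  then have "\<theta> = smul c (\<psi> (a, b, m)) + smul d (\<psi>' (a, b, m))"
    by (simp add: \<eta>_def algebra_simps del: \<psi>.simps \<psi>'.simps)
  then show "\<theta> \<in> der.span {\<psi> (a, b, m), \<psi>' (a, b, m)}"
    by (simp add: der.span_add der.span_scale der.span_base del: \<psi>.simps \<psi>'.simps)
qed

lemma is_basis_iff_\<psi>_in_D: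
  "is_basis {\<psi> \<mu>, \<psi>' \<mu>} (D \<mu> :: 'p::prime_card der set) \<longleftrightarrow> \<psi> \<mu> \<in> (D \<mu> :: 'p der set)"
proof
  assume "is_basis {\<psi> \<mu>, \<psi>' \<mu> :: 'p der} (D \<mu>)"
  then show "(\<psi> \<mu> :: 'p der) \<in> D \<mu>"
    unfolding is_basis_def by (metis der.span_base insertI1)
next
  assume in_D: "(\<psi> \<mu> :: 'p der) \<in> D \<mu>"
  obtain a b m where \<mu>: "\<mu> = (a, b, m)"
    by (cases \<mu>)
  have "der.span {\<psi> \<mu>, \<psi>' \<mu>} \<subseteq> (D \<mu> :: 'p der set)"
    using in_D \<psi>'_in_D by (intro der.span_minimal subspace_D) blast
  then show "is_basis {\<psi> \<mu>, \<psi>' \<mu>} (D \<mu> :: 'p der set)"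
    unfolding is_basis_def using D_subset_span independent_\<psi>_\<psi>' in_D unfolding \<mu> by blast
qed

theorem theorem5p3:
  fixes m :: nat
  assumes "m > 0"
  shows "\<Gamma> TYPE('p::prime_card) m =
    {\<mu> \<in> \<Lambda> m. \<forall>j \<in> J \<mu>. [m choose j = 0] (mod CARD('p))}"
  by (auto simp only: \<Gamma>_def is_basis_iff_\<psi>_in_D \<psi>_in_D_iff \<Lambda>_def mem_Collect_eq case_prod_conv
      snd_conv)

end
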